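(* Let $S\subset\mathbb{R}^n$ be a closed convex set containing the origin, and let $\{\rho^\nu\}_{\nu\in\mathbb{N}}\subset[0,\infty)$ and $\{q^\nu\}_{\nu\in\mathbb{N}}\subset\mathbb{N}$ be sequences that both tend to $\infty$. Then $$\bigcup_{\nu\in\mathbb{N}} \mathrm{pa\text{-}fcns}^{q^\nu}_{\rho^\nu}(S)\ \text{ is hypo-dense in } \mathrm{usc\text{-}fcns}(S),$$ that is, every $f\in\mathrm{usc\text{-}fcns}(S)$ is the limit of a hypo-converging sequence of functions from this union.
   Context: Let $\mathbb{N}=\{1,2,\dots\}$ and $\overline{\mathbb{R}}=[-\infty,\infty]$. For $f:S\to\overline{\mathbb{R}}$, the hypograph is $\mathrm{hypo} f=\{(x,\alpha)\in S\times\mathbb{R} : f(x)\ge\alpha\}$, and $$\mathrm{usc\text{-}fcns}(S)=\{f:S\to\overline{\mathbb{R}} : \mathrm{hypo} f \text{ is nonempty and closed}\}.$$ Hypo-convergence: for $f^\nu,f\in\mathrm{usc\text{-}fcns}(S)$, $f^\nu$ hypo-converges to $f$ if the sets $\mathrm{hypo} f^\nu$ set-converge (Painlevé–Kuratowski) to $\mathrm{hypo} f$. Equivalently: (i) whenever $x^\nu\in S$ and $x^\nu\to x$, $\limsup_\nu f^\nu(x^\nu)\le f(x)$; and (ii) for every $x\in S$ there exist $x^\nu\in S$ with $x^\nu\to x$ and $\liminf_\nu f^\nu(x^\nu)\ge f(x)$. For $\rho\in[0,\infty)$ let $\rho\mathbb{B}_\infty=\{x:\|x\|_\infty\le\rho\}$.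 For $\rho\in[0,\infty)$ and $q\in\mathbb{N}$, $\mathrm{pa\text{-}fcns}^{q}_\rho(S)$ is the set of all functions $f:S\to[-\infty,\infty)$ for which there exist $a^k,b^k\in\mathbb{R}^n$ and $\alpha_k,\beta_k\in\mathbb{R}$, $k=1,\dots,q$, such that $$f(x)=\max_{k=1,\dots,q}\big[\langle a^k,x\rangle+\alpha_k\big]-\max_{k=1,\dots,q}\big[\langle b^k,x\rangle+\beta_k\big]\quad\text{for all } x\in S\cap\rho\mathbb{B}_\infty,$$ and $f(x)=-\infty$ for all other $x\in S$. A set $U\subset\mathrm{usc\text{-}fcns}(S)$ is hypo-dense in $\mathrm{usc\text{-}fcns}(S)$ if every $f\in\mathrm{usc\text{-}fcns}(S)$ is the limit of a hypo-converging sequence $\{f^\nu\in U,\ \nu\in\mathbb{N}\}$. *)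

theory Defs
  imports "HOL-Analysis.Analysis"
begin

text \<open>
  A function from \<open>S\<close> to the extended reals is a member of \<open>S \<rightarrow>\<^sub>E UNIV\<close>: its values off \<open>S\<close> are
  pinned to \<open>undefined\<close>, so that distinct members differ at some point of \<open>S\<close>.
\<close>

definition hypo :: "(real ^ 'n) set \<Rightarrow> (real ^ 'n \<Rightarrow> ereal) \<Rightarrow> ((real ^ 'n) \<times> real) set" where
  "hypo S f = {(x, \<alpha>). x \<in> S \<and> f x \<ge> ereal \<alpha>}"

definition usc_fcns :: "(real ^ 'n) set \<Rightarrow> (real ^ 'n \<Rightarrow> ereal) set" where
  "usc_fcns S = {f \<in> S \<rightarrow>\<^sub>E UNIV. hypo S f \<noteq> {} \<and> closed (hypo S f)}"

text \<open>
  Set convergence is in the sense of Painleve--Kuratowski. The inner limit asks for \<open>y \<nu> \<in> C \<nu>\<close> only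
  eventually, so that finitely many empty sets do not matter; hypographs of members of
  \<open>usc_fcns S\<close> are never empty, and for them this is the same as asking it for all \<open>\<nu>\<close>.
\<close>

definition inner_limit :: "(nat \<Rightarrow> 'a::topological_space set) \<Rightarrow> 'a set" where
  "inner_limit C = {x. \<exists>y. (\<forall>\<^sub>F \<nu> in sequentially. y \<nu> \<in> C \<nu>) \<and> y \<longlonglongrightarrow> x}"

definition outer_limit :: "(nat \<Rightarrow> 'a::topological_space set) \<Rightarrow> 'a set" where
  "outer_limit C = {x. \<exists>r y. strict_mono r \<and> (\<forall>k::nat. y k \<in> C (r k)) \<and> y \<longlonglongrightarrow> x}"

definition set_converges :: "(nat \<Rightarrow> 'a::topological_space set) \<Rightarrow> 'a set \<Rightarrow> bool" where
  "set_converges C D \<longleftrightarrow> inner_limit C = D \<and> outer_limit C = D"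

definition hypo_converges ::
  "(real ^ 'n) set \<Rightarrow> (nat \<Rightarrow> real ^ 'n \<Rightarrow> ereal) \<Rightarrow> (real ^ 'n \<Rightarrow> ereal) \<Rightarrow> bool" where
  "hypo_converges S F f \<longleftrightarrow> set_converges (\<lambda>\<nu>. hypo S (F \<nu>)) (hypo S f)"

definition hypo_dense :: "(real ^ 'n) set \<Rightarrow> (real ^ 'n \<Rightarrow> ereal) set \<Rightarrow> bool" where
  "hypo_dense S U \<longleftrightarrow> U \<subseteq> usc_fcns S \<and>
     (\<forall>f \<in> usc_fcns S. \<exists>F. (\<forall>\<nu>. F \<nu> \<in> U) \<and> hypo_converges S F f)"

text \<open>
  Meaningful for \<open>q \<ge> 1\<close> only, since \<open>Max {}\<close> is unspecified.
\<close>

definition pa_fcns :: "nat \<Rightarrow> real \<Rightarrow> (real ^ 'n) set \<Rightarrow> (real ^ 'n \<Rightarrow> ereal) set" where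
  "pa_fcns q \<rho> S = {f \<in> S \<rightarrow>\<^sub>E {..<\<infinity>}.
     \<exists>(a :: nat \<Rightarrow> real ^ 'n) (b :: nat \<Rightarrow> real ^ 'n) (\<alpha> :: nat \<Rightarrow> real) (\<beta> :: nat \<Rightarrow> real).
       \<forall>x\<in>S. f x =
         (if infnorm x \<le> \<rho>
          then ereal (Max ((\<lambda>k. a k \<bullet> x + \<alpha> k) ` {1..q}) - Max ((\<lambda>k. b k \<bullet> x + \<beta> k) ` {1..q}))
          else - \<infinity>)}"

end

theory Submission
  imports Defs "HOL-Real_Asymp.Real_Asymp"
begin

text \<open>
  Let \<open>C\<close> be the hypograph of \<open>f\<close>. Pick a finite \<open>1/j\<close>-net of the part of \<open>C\<close> in the ball of radius \<open>j\<close>,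
  together with one fixed point of \<open>C\<close>, and put under each net point \<open>(p, c)\<close> the steep tent
  \<open>x \<mapsto> c - K \<cdot> \<parallel>x - p\<parallel>\<^sub>1\<close>, where \<open>K\<close> is of order \<open>j\<^sup>2\<close>. The maximum of these tents is a
  difference of maxima of finitely many affine functions on the whole space, so its restriction to the box of radius
  \<open>\<rho> \<nu>\<close> is in the union once \<open>\<nu>\<close> is large. Its hypograph contains the net, and a point \<open>(y, \<beta>)\<close> of it
  lies under a tent with \<open>c \<ge> \<beta>\<close> and \<open>\<parallel>y - p\<parallel>\<^sub>1 \<le> (c - \<beta>) / K\<close>. As \<open>c\<close> is at most of order
  \<open>j\<close>, the point \<open>(p, \<beta>)\<close> of \<open>C\<close> is close to \<open>(y, \<beta>)\<close>.
\<close>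

section \<open>Maxima of finitely many affine functions and their differences\<close>

text \<open>A set of (slope, intercept) pairs of unspecified finite size can grow freely under
  maxima and sums; the exact number of pieces is settled only on passing to
  \<open>pa_fcns\<close>.\<close>

definition max_affine :: "('a::real_inner \<Rightarrow> real) \<Rightarrow> bool" where
  "max_affine u \<longleftrightarrow> (\<exists>A. finite A \<and> A \<noteq> {} \<and> u = (\<lambda>x. Max ((\<lambda>(a, c). a \<bullet> x + c) ` A)))"

definition diff_max_affine :: "('a::real_inner \<Rightarrow> real) \<Rightarrow> bool" where
  "diff_max_affine g \<longleftrightarrow> (\<exists>u v. max_affine u \<and> max_affine v \<and> g = (\<lambda>x. u x - v x))"

lemma max_affineI:
  assumes "finite A" "A \<noteq> {}" "\<And>x. u x = Max ((\<lambda>(a, c). a \<bullet> x + c) ` A)"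
  shows "max_affine u"
  using assms unfolding max_affine_def by blast

lemma max_affine_affine: "max_affine (\<lambda>x. a \<bullet> x + c)"
  by (rule max_affineI[of "{(a, c)}"]) auto

lemma max_affine_max:
  assumes "max_affine u" "max_affine v"
  shows "max_affine (\<lambda>x. max (u x) (v x))"
proof -
  obtain A B where A: "finite A" "A \<noteq> {}" "u = (\<lambda>x. Max ((\<lambda>(a, c). a \<bullet> x + c) ` A))"
    and B: "finite B" "B \<noteq> {}" "v = (\<lambda>x. Max ((\<lambda>(a, c). a \<bullet> x + c) ` B))"
    using assms unfolding max_affine_def by blast
  show ?thesis
    by (rule max_affineI[of "A \<union> B"]) (use A B in \<open>auto simp: image_Un Max.union\<close>)
qed

text \<open>Take all pairwise sums of pieces: maximising over independent choices splits into the
  sum of the two maxima.\<close>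

lemma max_affine_add:
  fixes u v :: "'a::real_inner \<Rightarrow> real"
  assumes "max_affine u" "max_affine v"
  shows "max_affine (\<lambda>x. u x + v x)"
proof -
  obtain A B where A: "finite A" "A \<noteq> {}" "u = (\<lambda>x. Max ((\<lambda>(a, c). a \<bullet> x + c) ` A))"
    and B: "finite B" "B \<noteq> {}" "v = (\<lambda>x. Max ((\<lambda>(a, c). a \<bullet> x + c) ` B))"
    using assms unfolding max_affine_def by blast
  let ?C = "(\<lambda>((a, c), (b, d)). (a + b, c + d)) ` (A \<times> B)"
  show ?thesis
  proof (rule max_affineI)
    show "finite ?C" "?C \<noteq> {}" using A B by auto
    fix x
    let ?e = "\<lambda>(a :: 'a, c). a \<bullet> x + c"
    have "Max (?e ` ?C) = Max (?e ` A) + Max (?e ` B)"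
    proof (rule Max_eqI)
      show "finite (?e ` ?C)" using A B by auto
    next
      fix y assume "y \<in> ?e ` ?C"
      then obtain p r where "p \<in> A" "r \<in> B" "y = ?e p + ?e r"
        by (auto simp: inner_add_left)
      then show "y \<le> Max (?e ` A) + Max (?e ` B)"
        using A B by (auto intro!: add_mono Max_ge)
    next
      have "Max (?e ` A) \<in> ?e ` A" "Max (?e ` B) \<in> ?e ` B"
        using A B by (auto intro!: Max_in)
      then obtain p r where "p \<in> A" "r \<in> B" "Max (?e ` A) = ?e p" "Max (?e ` B) = ?e r"
        by auto
      then show "Max (?e ` A) + Max (?e ` B) \<in> ?e ` ?C"
        by (intro image_eqI[of _ _ "(fst p + fst r, snd p + snd r)"] image_eqI[of _ _ "(p, r)"])
          (auto simp: inner_add_left case_prod_beta)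
    qed
    then show "u x + v x = Max (?e ` ?C)" using A B by simp
  qed
qed

lemma max_affine_sum:
  assumes "finite I" "\<And>i. i \<in> I \<Longrightarrow> max_affine (u i)"
  shows "max_affine (\<lambda>x. \<Sum>i\<in>I. u i x)"
  using assms
proof (induction I)
  case empty
  then show ?case using max_affine_affine[of 0 0] by simp
next
  case (insert i I)
  then show ?case using max_affine_add[of "u i" "\<lambda>x. \<Sum>i\<in>I. u i x"] by simp
qed

text \<open>With t the difference of the i-th coordinates, \<open>K * \<bar>t\<bar>\<close> is the
  maximum of K t and - K t. The l1 distance serves because it is polyhedral and dominates the
  Euclidean norm.\<close>

lemma max_affine_l1_distance:
  fixes p :: "real ^ 'n"
  assumes "K \<ge> 0"
  shows "max_affine (\<lambda>x. K * (\<Sum>i\<in>UNIV. \<bar>x $ i - p $ i\<bar>))"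
proof -
  have "max_affine (\<lambda>x::real ^ 'n. K * \<bar>x $ i - p $ i\<bar>)" for i
  proof -
    have "(\<lambda>x::real ^ 'n. K * \<bar>x $ i - p $ i\<bar>) =
      (\<lambda>x. max (axis i K \<bullet> x + (- K * p $ i)) (axis i (- K) \<bullet> x + K * p $ i))"
    proof
      fix x :: "real ^ 'n"
      have "K * \<bar>x $ i - p $ i\<bar> = \<bar>K * (x $ i - p $ i)\<bar>"
        using assms by (simp add: abs_mult)
      then show "K * \<bar>x $ i - p $ i\<bar> =
        max (axis i K \<bullet> x + (- K * p $ i)) (axis i (- K) \<bullet> x + K * p $ i)"
        by (simp add: inner_axis' algebra_simps max_def abs_if)
    qed
    then show ?thesis
      by (simp only: max_affine_max max_affine_affine)
  qed
  then show ?thesis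
    unfolding sum_distrib_left by (intro max_affine_sum) auto
qed

text \<open>Over the common subtrahend \<open>v + v'\<close>, the two differences become
  \<open>u + v'\<close> and \<open>u' + v\<close>, whose maximum is again a maximum of affine
  functions.\<close>

lemma diff_max_affine_max:
  assumes "diff_max_affine g" "diff_max_affine h"
  shows "diff_max_affine (\<lambda>x. max (g x) (h x))"
proof -
  obtain u v u' v' where *: "max_affine u" "max_affine v" "g = (\<lambda>x. u x - v x)"
    "max_affine u'" "max_affine v'" "h = (\<lambda>x. u' x - v' x)"
    using assms unfolding diff_max_affine_def by blast
  have "(\<lambda>x. max (g x) (h x)) = (\<lambda>x. max (u x + v' x) (u' x + v x) - (v x + v' x))"
    using * by (auto simp: max_def)
  moreover have "max_affine (\<lambda>x. max (u x + v' x) (u' x + v x))" "max_affine (\<lambda>x. v x + v' x)"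
    using * by (auto intro!: max_affine_max max_affine_add)
  ultimately show ?thesis
    unfolding diff_max_affine_def by blast
qed

lemma diff_max_affine_Max:
  assumes "finite N" "N \<noteq> {}" "\<And>p. p \<in> N \<Longrightarrow> diff_max_affine (t p)"
  shows "diff_max_affine (\<lambda>x. Max ((\<lambda>p. t p x) ` N))"
  using assms
proof (induction N rule: finite_ne_induct)
  case (insert p N)
  then show ?case using diff_max_affine_max[of "t p" "\<lambda>x. Max ((\<lambda>p. t p x) ` N)"] by simp
qed simp

definition tent :: "real \<Rightarrow> (real ^ 'n) \<times> real \<Rightarrow> real ^ 'n \<Rightarrow> real" where
  "tent K p x = snd p - K * (\<Sum>i\<in>UNIV. \<bar>x $ i - fst p $ i\<bar>)"

lemma diff_max_affine_tent:
  assumes "K \<ge> 0"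
  shows "diff_max_affine (tent K p)"
  unfolding diff_max_affine_def
proof (intro exI conjI)
  show "max_affine (\<lambda>x. 0 \<bullet> x + snd p)" by (rule max_affine_affine)
  show "max_affine (\<lambda>x. K * (\<Sum>i\<in>UNIV. \<bar>x $ i - fst p $ i\<bar>))"
    using assms by (rule max_affine_l1_distance)
qed (auto simp: tent_def)

section \<open>Padding to exactly q pieces and membership in \<open>pa_fcns\<close>\<close>

lemma ex_image_atLeastAtMost_eq:
  assumes "finite A" "A \<noteq> {}" "card A \<le> q"
  shows "\<exists>h :: nat \<Rightarrow> _. h ` {1..q} = A"
proof -
  obtain e where e: "bij_betw e {1..card A} A"
    using assms(1) by (rule ex_bij_betw_nat_finite_1[THEN exE])
  \<comment> \<open>Surplus indices all repeat the last element; repeated pieces do not change a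
    maximum.\<close>
  have "(\<lambda>k. min k (card A)) ` {1..q} = {1..card A}"
  proof
    show "(\<lambda>k. min k (card A)) ` {1..q} \<subseteq> {1..card A}"
      using assms by (auto simp: Suc_le_eq card_gt_0_iff)
    show "{1..card A} \<subseteq> (\<lambda>k. min k (card A)) ` {1..q}"
    proof
      fix k assume "k \<in> {1..card A}"
      then show "k \<in> (\<lambda>k. min k (card A)) ` {1..q}"
        using assms by (intro image_eqI[of _ _ k]) auto
    qed
  qed
  then have "(\<lambda>k. e (min k (card A))) ` {1..q} = A"
    using e unfolding bij_betw_def by (metis image_image)
  then show ?thesis by blast
qed

lemma max_affine_eventually_indexed:
  assumes "max_affine u"
  shows "\<exists>m. \<forall>q\<ge>m. \<exists>(a :: nat \<Rightarrow> 'a::real_inner) \<alpha>. \<forall>x. u x = Max ((\<lambda>k. a k \<bullet> x + \<alpha> k) ` {1..q})"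
proof -
  obtain A where A: "finite A" "A \<noteq> {}" "u = (\<lambda>x. Max ((\<lambda>(a, c). a \<bullet> x + c) ` A))"
    using assms unfolding max_affine_def by blast
  have "\<exists>(a :: nat \<Rightarrow> 'a) \<alpha>. \<forall>x. u x = Max ((\<lambda>k. a k \<bullet> x + \<alpha> k) ` {1..q})" if q: "q \<ge> card A" for q
  proof -
    obtain h where h: "h ` {1..q} = A"
      using ex_image_atLeastAtMost_eq[OF A(1,2) q] by blast
    show ?thesis
      by (rule exI[of _ "fst \<circ> h"], rule exI[of _ "snd \<circ> h"])
        (simp add: A(3) h[symmetric] image_image case_prod_beta)
  qed
  then show ?thesis by blast
qed

definition box_restriction :: "(real ^ 'n) set \<Rightarrow> real \<Rightarrow> (real ^ 'n \<Rightarrow> real) \<Rightarrow> real ^ 'n \<Rightarrow> ereal" where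
  "box_restriction S r g = (\<lambda>x\<in>S. if infnorm x \<le> r then ereal (g x) else - \<infinity>)"

lemma hypo_box_restriction:
  "hypo S (box_restriction S r g) = {(x, \<alpha>). x \<in> S \<and> infnorm x \<le> r \<and> \<alpha> \<le> g x}"
  by (auto simp: hypo_def box_restriction_def split: if_splits)

text \<open>The threshold depends on \<open>g\<close> alone, so a box radius and a number of pieces
  can be chosen after \<open>g\<close> is built.\<close>

lemma diff_max_affine_eventually_pa_fcns:
  fixes g :: "real ^ 'n \<Rightarrow> real"
  assumes "diff_max_affine g"
  shows "\<exists>m. \<forall>q\<ge>m. \<forall>r S. box_restriction S r g \<in> pa_fcns q r S"
proof -
  obtain u v where uv: "max_affine u" "max_affine v" "g = (\<lambda>x. u x - v x)"
    using assms unfolding diff_max_affine_def by blast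
  obtain m where m: "\<And>q. q \<ge> m \<Longrightarrow> \<exists>(a :: nat \<Rightarrow> real ^ 'n) \<alpha>. \<forall>x. u x = Max ((\<lambda>k. a k \<bullet> x + \<alpha> k) ` {1..q})"
    using max_affine_eventually_indexed[OF uv(1)] by blast
  obtain m' where m': "\<And>q. q \<ge> m' \<Longrightarrow> \<exists>(a :: nat \<Rightarrow> real ^ 'n) \<alpha>. \<forall>x. v x = Max ((\<lambda>k. a k \<bullet> x + \<alpha> k) ` {1..q})"
    using max_affine_eventually_indexed[OF uv(2)] by blast
  have "box_restriction S r g \<in> pa_fcns q r S" if q: "q \<ge> max m m'" for q r S
  proof -
    obtain a \<alpha> where a: "\<And>x. u x = Max ((\<lambda>k. a k \<bullet> x + \<alpha> k) ` {1..q})"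
      using m[of q] q by auto
    obtain b \<beta> where b: "\<And>x. v x = Max ((\<lambda>k. b k \<bullet> x + \<beta> k) ` {1..q})"
      using m'[of q] q by auto
    have "box_restriction S r g \<in> S \<rightarrow>\<^sub>E {..<\<infinity>}"
      by (auto simp: box_restriction_def)
    moreover have "\<forall>x\<in>S. box_restriction S r g x =
        (if infnorm x \<le> r
         then ereal (Max ((\<lambda>k. a k \<bullet> x + \<alpha> k) ` {1..q}) - Max ((\<lambda>k. b k \<bullet> x + \<beta> k) ` {1..q}))
         else - \<infinity>)"
      by (simp add: box_restriction_def uv(3) a b)
    ultimately show ?thesis
      unfolding pa_fcns_def by blast
  qed
  then show ?thesis by blast
qed

section \<open>Closed nonempty hypographs of the approximants\<close>

lemma continuous_on_Max_image:
  fixes h :: "'i \<Rightarrow> 'a::topological_space \<Rightarrow> real"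
  assumes "finite I" "I \<noteq> {}" "\<And>i. i \<in> I \<Longrightarrow> continuous_on T (h i)"
  shows "continuous_on T (\<lambda>x. Max ((\<lambda>i. h i x) ` I))"
  using assms by (induction I rule: finite_ne_induct) (auto intro!: continuous_on_max)

text \<open>The formula is continuous on the whole space, so the hypograph is an intersection of
  three closed sets. The origin lies in \<open>S\<close> and in every box, which makes the hypograph
  nonempty.\<close>

lemma pa_fcns_subset_usc_fcns:
  fixes S :: "(real ^ 'n) set"
  assumes "closed S" "0 \<in> S" "r \<ge> 0" "q \<ge> 1"
  shows "pa_fcns q r S \<subseteq> usc_fcns S"
proof
  fix G assume "G \<in> pa_fcns q r S"
  then obtain a b :: "nat \<Rightarrow> real ^ 'n" and \<alpha> \<beta> :: "nat \<Rightarrow> real" where G: "G \<in> S \<rightarrow>\<^sub>E {..<\<infinity>}"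
    and eq: "\<forall>x\<in>S. G x = (if infnorm x \<le> r
          then ereal (Max ((\<lambda>k. a k \<bullet> x + \<alpha> k) ` {1..q}) - Max ((\<lambda>k. b k \<bullet> x + \<beta> k) ` {1..q}))
          else - \<infinity>)"
    unfolding pa_fcns_def by blast
  define g where "g = (\<lambda>x. Max ((\<lambda>k. a k \<bullet> x + \<alpha> k) ` {1..q}) - Max ((\<lambda>k. b k \<bullet> x + \<beta> k) ` {1..q}))"
  have hypo: "hypo S G = {(x, \<gamma>). x \<in> S \<and> infnorm x \<le> r \<and> \<gamma> \<le> g x}"
  proof -
    have "\<forall>x\<in>S. G x = (if infnorm x \<le> r then ereal (g x) else - \<infinity>)"
      using eq unfolding g_def .
    then show ?thesis by (auto simp: hypo_def split: if_splits)
  qed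
  have "continuous_on UNIV g"
    unfolding g_def using \<open>q \<ge> 1\<close>
    by (intro continuous_on_diff continuous_on_Max_image) (auto intro!: continuous_intros)
  then have "continuous_on UNIV (\<lambda>p :: (real ^ 'n) \<times> real. g (fst p))"
    by (rule continuous_on_compose2) (auto intro: continuous_on_fst continuous_on_id)
  then have "closed {p :: (real ^ 'n) \<times> real. snd p \<le> g (fst p)}"
    by (rule closed_Collect_le[OF continuous_on_snd[OF continuous_on_id]])
  moreover have "closed {p :: (real ^ 'n) \<times> real. infnorm (fst p) \<le> r}"
    by (intro closed_Collect_le continuous_on_infnorm continuous_on_fst continuous_on_id
        continuous_on_const)
  moreover have "closed (S \<times> (UNIV :: real set))"
    using \<open>closed S\<close> by (intro closed_Times) auto
  moreover have "hypo S G = (S \<times> UNIV) \<inter> {p. infnorm (fst p) \<le> r} \<inter> {p. snd p \<le> g (fst p)}"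
    unfolding hypo by auto
  ultimately have "closed (hypo S G)"
    by (simp add: closed_Int)
  moreover have "(0, g 0) \<in> hypo S G"
    using \<open>0 \<in> S\<close> \<open>r \<ge> 0\<close> by (simp add: hypo infnorm_0)
  ultimately show "G \<in> usc_fcns S"
    using G unfolding usc_fcns_def by auto
qed

section \<open>Approximating a hypograph by finitely many tents\<close>

text \<open>One \<open>g\<close> serves all box radii \<open>r\<close>: the net lies in every box
  with \<open>R \<le> r\<close>, and the second estimate comes from the tents themselves. It moves
  points only horizontally, keeping the height \<open>\<beta>\<close>.\<close>

lemma hypo_tent_approximation:
  fixes f :: "real ^ 'n \<Rightarrow> ereal"
  assumes closed: "closed (hypo S f)" and p0: "p0 \<in> hypo S f" and "K > 0" "\<epsilon> > 0"
    and R: "norm p0 \<le> R"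
  obtains g where "diff_max_affine g"
    and "\<And>r p. p \<in> hypo S f \<Longrightarrow> norm p \<le> R \<Longrightarrow> R \<le> r \<Longrightarrow>
            \<exists>p'\<in>hypo S (box_restriction S r g). dist p' p < \<epsilon>"
    and "\<And>r y \<beta>. (y, \<beta>) \<in> hypo S (box_restriction S r g) \<Longrightarrow>
            \<exists>x. (x, \<beta>) \<in> hypo S f \<and> norm (y - x) \<le> (R - \<beta>) / K"
proof -
  let ?D = "hypo S f \<inter> cball 0 R"
  have "compact ?D"
    using closed by (simp add: closed_Int_compact)
  then have "\<exists>N. finite N \<and> N \<subseteq> ?D \<and> ?D \<subseteq> (\<Union>p\<in>N. ball p \<epsilon>)"
    using \<open>\<epsilon> > 0\<close> by (intro seq_compact_imp_totally_bounded[rule_format] compact_imp_seq_compact)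
  then obtain N where net: "finite N" "N \<subseteq> ?D" "?D \<subseteq> (\<Union>p\<in>N. ball p \<epsilon>)"
    by blast
  have N: "finite N" "N \<noteq> {}" "\<And>p. p \<in> N \<Longrightarrow> p \<in> hypo S f" "\<And>p. p \<in> N \<Longrightarrow> norm p \<le> R"
  proof -
    \<comment> \<open>The bound on \<open>p0\<close> keeps the net nonempty, so that the maximum of
      tents is meaningful.\<close>
    have "p0 \<in> ?D" using p0 R by simp
    then show "N \<noteq> {}" using net(3) by blast
  qed (use net in auto)
  define g where "g x = Max ((\<lambda>p. tent K p x) ` N)" for x
  show thesis
  proof (rule that[of g])
    show "diff_max_affine g"
      unfolding g_def using N \<open>K > 0\<close> by (intro diff_max_affine_Max diff_max_affine_tent) auto
  next
    fix r p assume p: "p \<in> hypo S f" "norm p \<le> R" and r: "R \<le> r"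
    then have "p \<in> ?D" by simp
    then obtain p' where "p' \<in> N" "p \<in> ball p' \<epsilon>"
      using net(3) by blast
    then have p': "p' \<in> N" "dist p' p < \<epsilon>"
      by simp_all
    \<comment> \<open>Sup norm \<le> Euclidean norm \<le> norm of the pair \<le> \<open>R\<close>
      \<le> \<open>r\<close>: cutting off to the box loses no net point.\<close>
    have "infnorm (fst p') \<le> r"
      using infnorm_le_norm[of "fst p'"] norm_fst_le[of "fst p'" "snd p'"] N(4)[OF p'(1)] r by simp
    moreover have "snd p' = tent K p' (fst p')"
      by (simp add: tent_def)
    then have "snd p' \<le> g (fst p')"
      unfolding g_def using N(1) p'(1) by (auto intro!: Max_ge)
    moreover have "fst p' \<in> S"
      using N(3)[OF p'(1)] by (auto simp: hypo_def)
    ultimately have "p' \<in> hypo S (box_restriction S r g)"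
      by (auto simp: hypo_box_restriction case_prod_beta)
    then show "\<exists>p'\<in>hypo S (box_restriction S r g). dist p' p < \<epsilon>"
      using p'(2) by blast
  next
    fix r y \<beta> assume "(y, \<beta>) \<in> hypo S (box_restriction S r g)"
    then have "\<beta> \<le> g y"
      by (simp add: hypo_box_restriction)
    moreover have "g y \<in> (\<lambda>p. tent K p y) ` N"
      unfolding g_def using N by (intro Max_in) auto
    ultimately obtain p where p: "p \<in> N" "\<beta> \<le> tent K p y"
      by auto
    have "norm (y - fst p) \<le> (\<Sum>i\<in>UNIV. \<bar>y $ i - fst p $ i\<bar>)"
      using norm_le_l1_cart[of "y - fst p"] by simp
    then have "K * norm (y - fst p) \<le> K * (\<Sum>i\<in>UNIV. \<bar>y $ i - fst p $ i\<bar>)"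
      using \<open>K > 0\<close> by simp
    then have \<beta>: "\<beta> + K * norm (y - fst p) \<le> snd p"
      using p(2) by (simp add: tent_def)
    moreover have "snd p \<le> R"
      using norm_snd_le[of "snd p" "fst p"] N(4)[OF p(1)] by simp
    ultimately have "norm (y - fst p) \<le> (R - \<beta>) / K"
      using \<open>K > 0\<close> by (simp add: field_simps)
    moreover have "0 \<le> K * norm (y - fst p)"
      using \<open>K > 0\<close> by simp
    then have "\<beta> \<le> snd p"
      using \<beta> by linarith
    \<comment> \<open>Hypographs are closed downwards, so the net point may be lowered to height
      \<open>\<beta>\<close>.\<close>
    then have "(fst p, \<beta>) \<in> hypo S f"
      using N(3)[OF p(1)] order_trans[of "ereal \<beta>" "ereal (snd p)"] by (auto simp: hypo_def)
    ultimately show "\<exists>x. (x, \<beta>) \<in> hypo S f \<and> norm (y - x) \<le> (R - \<beta>) / K"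
      by blast
  qed
qed

section \<open>Criteria for Painleve-Kuratowski and hypo-convergence\<close>

lemma inner_limit_subset_outer_limit: "inner_limit C \<subseteq> outer_limit C"
proof
  fix x assume "x \<in> inner_limit C"
  then obtain y N where y: "y \<longlonglongrightarrow> x" "\<And>n. n \<ge> N \<Longrightarrow> y n \<in> C n"
    by (auto simp: inner_limit_def eventually_sequentially)
  have "strict_mono (\<lambda>k. k + N)"
    by (simp add: strict_mono_def)
  moreover have "(\<lambda>k. y (k + N)) \<longlonglongrightarrow> x"
    using y(1) by (rule LIMSEQ_ignore_initial_segment)
  ultimately show "x \<in> outer_limit C"
    using y(2) unfolding outer_limit_def by (auto intro!: exI[of _ "\<lambda>k. k + N"] exI[of _ "\<lambda>k. y (k + N)"])
qed

lemma set_convergesI: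
  assumes "D \<subseteq> inner_limit C" "outer_limit C \<subseteq> D"
  shows "set_converges C D"
  using assms inner_limit_subset_outer_limit[of C] unfolding set_converges_def by blast

text \<open>The rates are those of the tent approximation with R = j + c, \<epsilon> = 1/(j+1) and K
  = (j+1)^2. The quadratic slope beats the linear bound on the heights, so the horizontal error
  vanishes along any convergent sequence.\<close>

lemma hypo_convergesI:
  fixes f :: "real ^ 'n \<Rightarrow> ereal"
  assumes closed: "closed (hypo S f)"
    and inner: "\<And>j p. p \<in> hypo S f \<Longrightarrow> norm p \<le> real j + c \<Longrightarrow>
            \<exists>p'\<in>hypo S (F j). dist p' p < 1 / (real j + 1)"
    and outer: "\<And>j y \<beta>. (y, \<beta>) \<in> hypo S (F j) \<Longrightarrow>
            \<exists>x. (x, \<beta>) \<in> hypo S f \<and> norm (y - x) \<le> (real j + c - \<beta>) / (real j + 1)\<^sup>2"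
  shows "hypo_converges S F f"
  unfolding hypo_converges_def
proof (rule set_convergesI; rule subsetI)
  fix p assume p: "p \<in> hypo S f"
  obtain y where y: "\<And>j. norm p \<le> real j + c \<Longrightarrow> y j \<in> hypo S (F j) \<and> dist (y j) p < 1 / (real j + 1)"
  proof -
    \<comment> \<open>For the finitely many j whose ball misses \<open>p\<close>, the choice is
      arbitrary; the inner limit ignores them.\<close>
    have "\<exists>y. norm p \<le> real j + c \<longrightarrow> y \<in> hypo S (F j) \<and> dist y p < 1 / (real j + 1)" for j
      using inner[OF p, of j] by blast
    then have "\<exists>y. \<forall>j. norm p \<le> real j + c \<longrightarrow> y j \<in> hypo S (F j) \<and> dist (y j) p < 1 / (real j + 1)"
      by (intro choice allI)
    then show ?thesis using that by blast
  qed
  have "filterlim (\<lambda>j. real j + c) at_top sequentially"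
    by real_asymp
  then have ev: "\<forall>\<^sub>F j in sequentially. norm p \<le> real j + c"
    by (simp add: filterlim_at_top)
  have "(\<lambda>j. dist (y j) p) \<longlonglongrightarrow> 0"
  proof (rule tendsto_sandwich[OF _ _ tendsto_const])
    show "\<forall>\<^sub>F j in sequentially. dist (y j) p \<le> 1 / (real j + 1)"
      using ev by eventually_elim (use y in \<open>simp add: less_imp_le\<close>)
    show "(\<lambda>j. 1 / (real j + 1)) \<longlonglongrightarrow> 0" by real_asymp
  qed simp
  then have "y \<longlonglongrightarrow> p"
    by (rule tendsto_dist_iff[THEN iffD2])
  moreover have "\<forall>\<^sub>F j in sequentially. y j \<in> hypo S (F j)"
    using ev by eventually_elim (use y in simp)
  ultimately show "p \<in> inner_limit (\<lambda>\<nu>. hypo S (F \<nu>))"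
    unfolding inner_limit_def by blast
next
  fix p assume "p \<in> outer_limit (\<lambda>\<nu>. hypo S (F \<nu>))"
  then obtain r z where r: "strict_mono r" and z: "\<And>k. z k \<in> hypo S (F (r k))" and lim: "z \<longlonglongrightarrow> p"
    unfolding outer_limit_def by blast
  define y \<beta> where "y = fst \<circ> z" and "\<beta> = snd \<circ> z"
  have y: "y \<longlonglongrightarrow> fst p" and \<beta>: "\<beta> \<longlonglongrightarrow> snd p"
    unfolding y_def \<beta>_def comp_def using lim by (auto intro: tendsto_fst tendsto_snd)
  \<comment> \<open>Each point is shifted at its own height into the hypograph of \<open>f\<close>.
    As \<open>\<beta>\<close> converges, the shift tends to zero, so the shifted points have the
    same limit and closedness applies.\<close>
  have "\<exists>x. (x, \<beta> k) \<in> hypo S f \<and> norm (y k - x) \<le> (real (r k) + c - \<beta> k) / (real (r k) + 1)\<^sup>2" for k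
    using z[of k] by (intro outer) (simp add: y_def \<beta>_def)
  then obtain x where x: "\<And>k. (x k, \<beta> k) \<in> hypo S f"
    and yx: "\<And>k. norm (y k - x k) \<le> (real (r k) + c - \<beta> k) / (real (r k) + 1)\<^sup>2"
    by metis
  have r': "filterlim r at_top sequentially"
    using r by (rule filterlim_subseq)
  have lim1: "(\<lambda>k. (real (r k) + c) / (real (r k) + 1)\<^sup>2) \<longlonglongrightarrow> 0"
    by (rule filterlim_compose[OF _ r', where g = "\<lambda>j. (real j + c) / (real j + 1)\<^sup>2"]) real_asymp
  have lim2: "(\<lambda>k. 1 / (real (r k) + 1)\<^sup>2) \<longlonglongrightarrow> 0"
    by (rule filterlim_compose[OF _ r', where g = "\<lambda>j. 1 / (real j + 1)\<^sup>2"]) real_asymp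
  have "(\<lambda>k. (real (r k) + c - \<beta> k) / (real (r k) + 1)\<^sup>2) \<longlonglongrightarrow> 0"
    using tendsto_diff[OF lim1 tendsto_mult[OF \<beta> lim2]] by (simp add: diff_divide_distrib)
  then have "(\<lambda>k. y k - x k) \<longlonglongrightarrow> 0"
    by (rule Lim_null_comparison[rotated]) (use yx in simp)
  from tendsto_diff[OF y this] have "x \<longlonglongrightarrow> fst p"
    by simp
  then have "(\<lambda>k. (x k, \<beta> k)) \<longlonglongrightarrow> (fst p, snd p)"
    using \<beta> by (rule tendsto_Pair)
  then show "p \<in> hypo S f"
    using closed_sequentially[OF closed, of "\<lambda>k. (x k, \<beta> k)"] x by simp
qed

section \<open>Density of the union\<close>

theorem theorem3p1:
  fixes S :: "(real ^ 'n) set" and \<rho> :: "nat \<Rightarrow> real" and q :: "nat \<Rightarrow> nat"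
  assumes "closed S" and "convex S" and "0 \<in> S"
    and "\<And>\<nu>. \<rho> \<nu> \<ge> 0" and "\<And>\<nu>. q \<nu> \<ge> 1"
    and "filterlim \<rho> at_top sequentially" and "filterlim q at_top sequentially"
  shows "hypo_dense S (\<Union>\<nu>. pa_fcns (q \<nu>) (\<rho> \<nu>) S)"
  unfolding hypo_dense_def
proof (intro conjI ballI)
  show "(\<Union>\<nu>. pa_fcns (q \<nu>) (\<rho> \<nu>) S) \<subseteq> usc_fcns S"
    by (intro UN_least pa_fcns_subset_usc_fcns assms)
next
  fix f assume "f \<in> usc_fcns S"
  then obtain p0 where p0: "p0 \<in> hypo S f" and closed: "closed (hypo S f)"
    unfolding usc_fcns_def by blast
  \<comment> \<open>\<open>P\<close> bundles membership in the union with the two estimates required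
    by \<open>hypo_convergesI\<close>. The offset c = \<open>norm p0\<close> puts \<open>p0\<close>
    in the ball already for j = 0.\<close>
  define P where "P j G \<longleftrightarrow> G \<in> (\<Union>\<nu>. pa_fcns (q \<nu>) (\<rho> \<nu>) S) \<and>
      (\<forall>p. p \<in> hypo S f \<longrightarrow> norm p \<le> real j + norm p0 \<longrightarrow>
            (\<exists>p'\<in>hypo S G. dist p' p < 1 / (real j + 1))) \<and>
      (\<forall>y \<beta>. (y, \<beta>) \<in> hypo S G \<longrightarrow>
            (\<exists>x. (x, \<beta>) \<in> hypo S f \<and> norm (y - x) \<le> (real j + norm p0 - \<beta>) / (real j + 1)\<^sup>2))" for j G
  have "\<exists>G. P j G" for j
  proof -
    obtain g where g: "diff_max_affine g"
      "\<And>r p. p \<in> hypo S f \<Longrightarrow> norm p \<le> real j + norm p0 \<Longrightarrow> real j + norm p0 \<le> r \<Longrightarrow>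
            \<exists>p'\<in>hypo S (box_restriction S r g). dist p' p < 1 / (real j + 1)"
      "\<And>r y \<beta>. (y, \<beta>) \<in> hypo S (box_restriction S r g) \<Longrightarrow>
            \<exists>x. (x, \<beta>) \<in> hypo S f \<and> norm (y - x) \<le> (real j + norm p0 - \<beta>) / (real j + 1)\<^sup>2"
      by (rule hypo_tent_approximation[OF closed p0, of "(real j + 1)\<^sup>2" "1 / (real j + 1)" "real j + norm p0"])
        auto
    obtain m where m: "\<And>q r. q \<ge> m \<Longrightarrow> box_restriction S r g \<in> pa_fcns q r S"
      using diff_max_affine_eventually_pa_fcns[OF g(1)] by blast
    \<comment> \<open>With \<open>g\<close> and hence \<open>m\<close> fixed, both divergent
      sequences pass their thresholds at a common index. It may vary freely with j, since only
      membership in the union matters.\<close>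
    have "\<forall>\<^sub>F \<nu> in sequentially. real j + norm p0 \<le> \<rho> \<nu> \<and> m \<le> q \<nu>"
      using assms(6,7) by (auto simp: filterlim_at_top intro: eventually_conj)
    then obtain \<nu> where \<nu>: "real j + norm p0 \<le> \<rho> \<nu>" "m \<le> q \<nu>"
      using eventually_happens by force
    show ?thesis
      unfolding P_def
    proof (intro exI[of _ "box_restriction S (\<rho> \<nu>) g"] conjI allI impI)
      show "box_restriction S (\<rho> \<nu>) g \<in> (\<Union>\<nu>. pa_fcns (q \<nu>) (\<rho> \<nu>) S)"
        using m[OF \<nu>(2)] by blast
    qed (use g(2)[OF _ _ \<nu>(1)] g(3) in auto)
  qed
  then obtain F where F: "\<And>j. P j (F j)"
    by metis
  have "hypo_converges S F f"
    by (rule hypo_convergesI[OF closed]) (use F in \<open>unfold P_def, blast+\<close>)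
  moreover have "\<forall>\<nu>. F \<nu> \<in> (\<Union>\<nu>. pa_fcns (q \<nu>) (\<rho> \<nu>) S)"
    using F unfolding P_def by simp
  ultimately show "\<exists>F. (\<forall>\<nu>. F \<nu> \<in> (\<Union>\<nu>. pa_fcns (q \<nu>) (\<rho> \<nu>) S)) \<and> hypo_converges S F f"
    by blast
qed

end
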